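(* Let $h(x)\in\mathcal{F}_0$, so that $(h(x^2),x)$ is an element of the aerated Appell subgroup of the Riordan group. Suppose that $$h(x^2)=\frac{g(x)g(-x)(1-x^2)+x^2 f(x)^2}{(1-x^2)^2}$$ for some $(g,f)\in\mathcal{F}_0\times\mathcal{F}_0$ with $f(x)$ an even power series. Then a square root of the aerated Appell array $(h(x^2),x)$ is given by the Sprugnoli array $M(g,f)$; that is, the matrix $M(g,f)$ with bivariate generating function $$\frac{g(x)}{(1-x)(1+yx)}+\frac{xf(x)}{(1-x^2)(1-yx)}$$ is a Sprugnoli array and satisfies $M(g,f)^2=(h(x^2),x)$.
   Context: All power series are formal power series with coefficients in $\mathbb{C}$. For $r\ge 0$, $\mathcal{F}_r=\{\sum_{n\ge r} a_n x^n \in \mathbb{C}[[x]] : a_r\neq 0\}$. The bivariate generating function of an infinite matrix $(t_{n,k})_{n,k\ge 0}$ is $\sum_{n,k\ge 0} t_{n,k}x^n y^k$, and $[x^n]$ denotes extraction of the coefficient of $x^n$. Squares of (lower-triangular) matrices are taken under ordinary matrix multiplication. For $u\in\mathcal{F}_0$, the Appell array $(u(x),x)$ is the lower-triangular infinite matrix with entries $t_{n,k}=[x^n]\,u(x)x^k$ for $n,k\ge 0$; these form a subgroup of the Riordan group. The aerated Appell subgroup consists of the arrays $(h(x^2),x)$ with $h\in\mathcal{F}_0$. A Sprugnoli array is a triple $(G,F_1,F_2)$ with $G\in\mathcal{F}_0$, $F_1\in\mathcal{F}_1$, and $F_2\in\mathcal{F}_1$ an odd power series (that is, $F_2\in x\mathbb{C}[[x^2]]$).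 It is identified with the lower-triangular infinite matrix with entries $$t_{n,k}=[x^n]\,G(x)\,F_1(x)^{k \bmod 2}\,(xF_2(x))^{\lfloor k/2\rfloor},\qquad n,k\ge 0.$$ *)

theory Defs
  imports
    Complex_Main
    "HOL-Library.Groups_Big_Fun"
    "HOL-Computational_Algebra.Formal_Power_Series"
begin

unbundle fps_syntax

type_synonym inf_matrix = "nat \<Rightarrow> nat \<Rightarrow> complex"

definition series_of_order :: "nat \<Rightarrow> complex fps set" where
  "series_of_order r = {a. (\<forall>n<r. a $ n = 0) \<and> a $ r \<noteq> 0}"

definition fps_even :: "complex fps \<Rightarrow> bool" where
  "fps_even a \<longleftrightarrow> (\<forall>n. odd n \<longrightarrow> a $ n = 0)"

definition fps_odd :: "complex fps \<Rightarrow> bool" where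
  "fps_odd a \<longleftrightarrow> (\<forall>n. even n \<longrightarrow> a $ n = 0)"

text \<open>
  The sum over all indices makes sense because it has finite support in each entry
  whenever the left factor is lower triangular.
\<close>

definition matrix_prod :: "inf_matrix \<Rightarrow> inf_matrix \<Rightarrow> inf_matrix" where
  "matrix_prod A B = (\<lambda>n k. Sum_any (\<lambda>j. A n j * B j k))"

definition appell_array :: "complex fps \<Rightarrow> inf_matrix" where
  "appell_array u = (\<lambda>n k. (u * fps_X ^ k) $ n)"

definition sprugnoli_matrix :: "complex fps \<Rightarrow> complex fps \<Rightarrow> complex fps \<Rightarrow> inf_matrix" where
  "sprugnoli_matrix G F1 F2 =
     (\<lambda>n k. (G * F1 ^ (k mod 2) * (fps_X * F2) ^ (k div 2)) $ n)"

definition sprugnoli_arrays :: "inf_matrix set" where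
  "sprugnoli_arrays =
     {sprugnoli_matrix G F1 F2 | G F1 F2.
        G \<in> series_of_order 0 \<and> F1 \<in> series_of_order 1 \<and>
        F2 \<in> series_of_order 1 \<and> fps_odd F2}"

text \<open>
  Bivariate series in \<open>x\<close> and \<open>y\<close> are series in \<open>x\<close> whose coefficients are series in \<open>y\<close>;
  thus \<open>(F $ n) $ k\<close> is the coefficient of \<open>x\<close> to the \<open>n\<close> times \<open>y\<close> to the \<open>k\<close>.
  The variable \<open>x\<close> is then the outer \<open>fps_X\<close>, and \<open>y\<close> is \<open>fps_const fps_X\<close>.
\<close>

definition bivariate_gf :: "inf_matrix \<Rightarrow> complex fps fps" where
  "bivariate_gf t = Abs_fps (\<lambda>n. Abs_fps (\<lambda>k. t n k))"

definition in_x :: "complex fps \<Rightarrow> complex fps fps" where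
  "in_x a = Abs_fps (\<lambda>n. fps_const (a $ n))"

abbreviation var_x :: "complex fps fps" where
  "var_x \<equiv> fps_X"

abbreviation var_y :: "complex fps fps" where
  "var_y \<equiv> fps_const fps_X"

text \<open>
  The quotients below are genuine although the coefficient ring \<open>complex fps\<close> is not a field:
  both denominators have constant coefficient \<open>1\<close> in \<open>x\<close>, see \<open>M_gf_mult\<close>.
\<close>

definition M_gf :: "complex fps \<Rightarrow> complex fps \<Rightarrow> complex fps fps" where
  "M_gf g f =
     in_x g / ((1 - var_x) * (1 + var_y * var_x)) +
     var_x * in_x f / ((1 - var_x ^ 2) * (1 - var_y * var_x))"

definition M_array :: "complex fps \<Rightarrow> complex fps \<Rightarrow> inf_matrix" where
  "M_array g f = (\<lambda>n k. (M_gf g f $ n) $ k)"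

lemma bivariate_gf_M_array: "bivariate_gf (M_array g f) = M_gf g f"
  by (simp add: bivariate_gf_def M_array_def fps_eq_iff)

lemma fps_fps_divide_mult:
  fixes a b :: "complex fps fps"
  assumes "b $ 0 = 1"
  shows "a / b * b = a"
proof -
  have "b * inverse b = 1"
    unfolding fps_inverse_def[of b] using assms
    by (intro fps_right_inverse) simp
  moreover have "a / b = a * inverse b"
    using assms by (intro fps_divide_unit) simp
  ultimately show ?thesis
    by (simp add: mult.assoc mult.commute[of _ b])
qed

lemma M_gf_mult:
  "in_x g / ((1 - var_x) * (1 + var_y * var_x)) * ((1 - var_x) * (1 + var_y * var_x)) = in_x g"
  "var_x * in_x f / ((1 - var_x ^ 2) * (1 - var_y * var_x)) * ((1 - var_x ^ 2) * (1 - var_y * var_x))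
     = var_x * in_x f"
  by (rule fps_fps_divide_mult, simp)+

end

theory Submission
  imports Defs
begin

text \<open>
  Put \<open>a = g / (1 - x)\<close> and \<open>b = x f / (1 - x\<^sup>2)\<close>. Expanding the two geometric series in \<open>y\<close>
  shows that column \<open>k\<close> of \<open>M(g,f)\<close> is \<open>((-1)\<^sup>k a + b) x\<^sup>k\<close> (\<open>M_array_nth\<close>). So only two
  series occur as column factors, \<open>a + b\<close> in even and \<open>b - a\<close> in odd columns. Such an array is the
  Sprugnoli array with \<open>G = a + b\<close>, \<open>F\<^sub>1 = x (b - a) / (a + b)\<close> and \<open>F\<^sub>2 = x\<close>
  (\<open>reflection_array_in_sprugnoli_arrays\<close>).

  For the square, let matrices act on power series, read as column vectors of coefficients. By
  linearity, the description of the columns says that \<open>M(g,f)\<close> sends \<open>u(x)\<close> to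
  \<open>a(x) u(-x) + b(x) u(x)\<close> (\<open>matrix_prod_reflection_array\<close>). Applying this operator twice gives
  \<open>(a(x) a(-x) + b(x)\<^sup>2) u(x) + a(x) (b(x) + b(-x)) u(-x)\<close>.
  Since \<open>f\<close> is even, \<open>b\<close> is odd and the second term vanishes. What remains is multiplication by
  \<open>a(x) a(-x) + b(x)\<^sup>2\<close>, that is, an Appell array (\<open>matrix_prod_reflection_array_square\<close>); and this
  series is \<open>g(x) g(-x) / (1 - x\<^sup>2) + x\<^sup>2 f(x)\<^sup>2 / (1 - x\<^sup>2)\<^sup>2 = h(x\<^sup>2)\<close>.
\<close>

section \<open>The reflection of a power series at the origin\<close>

lemma fps_reflect_nth:
  fixes u :: "'a :: comm_ring_1 fps"
  shows "(u oo - fps_X) $ n = (- 1) ^ n * u $ n"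
  by (simp add: fps_compose_uminus')

lemma fps_reflect_even: "fps_even u \<Longrightarrow> u oo - fps_X = u"
  by (auto simp: fps_eq_iff fps_reflect_nth fps_even_def uminus_power_if)

lemma fps_reflect_one_minus_X:
  "(1 - fps_X :: 'a :: comm_ring_1 fps) oo - fps_X = 1 + fps_X"
  by (simp add: fps_compose_sub_distrib)

lemma fps_reflect_X_power:
  "(fps_X ^ k :: 'a :: comm_ring_1 fps) oo - fps_X = fps_const ((- 1) ^ k) * fps_X ^ k"
  by (simp add: fps_eq_iff fps_reflect_nth)

section \<open>The columns of an array from its generating function\<close>

lemma in_x_mult: "in_x (u * v) = in_x u * in_x v"
proof (rule fps_ext)
  fix n
  have "fps_const (sum w A) = (\<Sum>i\<in>A. fps_const (w i))" for w :: "nat \<Rightarrow> complex" and A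
    by (simp add: fps_eq_iff fps_sum_nth)
  then show "in_x (u * v) $ n = (in_x u * in_x v) $ n"
    by (simp add: in_x_def fps_mult_nth)
qed

lemma in_x_diff: "in_x (u - v) = in_x u - in_x v"
  by (simp add: fps_eq_iff[where 'a = "complex fps"] in_x_def)

lemma in_x_one: "in_x 1 = 1"
  by (simp add: fps_eq_iff[where 'a = "complex fps"] in_x_def)

lemma in_x_X: "in_x fps_X = var_x"
  by (simp add: fps_eq_iff[where 'a = "complex fps"] in_x_def fps_X_def)

text \<open>
  The geometric series \<open>u / (1 - c y x)\<close>, stated as a product since \<open>complex fps\<close> is not a field.
  The cases \<open>c = -1\<close> and \<open>c = 1\<close> expand the two summands of \<open>M_gf\<close>.
\<close>

lemma bivariate_gf_geometric:
  "bivariate_gf (\<lambda>n k. (fps_const (c ^ k) * u * fps_X ^ k) $ n)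
     * (1 - fps_const (fps_const c) * (var_y * var_x)) = in_x u" (is "?S * _ = _")
proof -
  have "(?S * (1 - fps_const (fps_const c) * (var_y * var_x))) $ n $ k = in_x u $ n $ k" for n k
  proof -
    \<comment> \<open>On the coefficients of \<open>x\<^sup>n y\<^sup>k\<close>, the subtracted term is \<open>c\<close> times the entry one step up and to
      the left, which equals the entry itself unless \<open>k = 0\<close>.\<close>
    have "?S * (1 - fps_const (fps_const c) * (var_y * var_x))
            = ?S - fps_const (fps_const c) * (fps_const fps_X * (?S * var_x))"
      by (simp add: algebra_simps)
    then show ?thesis
      by (cases n; cases k)
        (simp_all add: bivariate_gf_def in_x_def mult.assoc fps_X_power_mult_right_nth
          del: fps_const_mult)
  qed
  then show ?thesis
    by (simp add: fps_eq_iff[where 'a = "complex fps"] fps_eq_iff[where 'a = complex])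
qed

lemma fps_fps_divide_eqI:
  fixes F D N :: "complex fps fps"
  assumes "F * D = N" and "D $ 0 = 1"
  shows "N / D = F"
proof -
  have "N / D * D = F * D"
    using fps_fps_divide_mult[OF assms(2)] assms(1) by simp
  moreover have "D \<noteq> 0"
    using assms(2) by auto
  ultimately show ?thesis
    by simp
qed

text \<open>
  The factors \<open>1 - x\<close> and \<open>1 - x\<^sup>2\<close> of the denominators do not involve \<open>y\<close>, so they are absorbed
  into \<open>a\<close> and \<open>b\<close>; the factors left over are those of geometric series in \<open>y\<close>.
\<close>

lemma M_array_nth:
  assumes "a * (1 - fps_X) = g" and "b * (1 - fps_X ^ 2) = fps_X * f"
  shows "M_array g f n k = ((fps_const ((- 1) ^ k) * a + b) * fps_X ^ k) $ n"
proof -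
  let ?A = "bivariate_gf (\<lambda>n k. (fps_const ((- 1) ^ k) * a * fps_X ^ k) $ n)"
  let ?B = "bivariate_gf (\<lambda>n k. (b * fps_X ^ k) $ n)"
  have "?A * (1 + var_y * var_x) = in_x a"
    using bivariate_gf_geometric[of "- 1" a] by (simp flip: fps_const_neg)
  then have "?A * ((1 - var_x) * (1 + var_y * var_x)) = in_x a * in_x (1 - fps_X)"
    by (simp add: in_x_diff in_x_one in_x_X mult.left_commute mult.commute)
  also have "\<dots> = in_x g"
    by (simp add: assms flip: in_x_mult)
  finally have A: "in_x g / ((1 - var_x) * (1 + var_y * var_x)) = ?A"
    by (rule fps_fps_divide_eqI) simp
  have "?B * (1 - var_y * var_x) = in_x b"
    using bivariate_gf_geometric[of 1 b] by simp
  then have "?B * ((1 - var_x ^ 2) * (1 - var_y * var_x)) = in_x b * in_x (1 - fps_X ^ 2)"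
    by (simp add: in_x_diff in_x_one in_x_mult in_x_X power2_eq_square mult.left_commute mult.commute)
  also have "\<dots> = var_x * in_x f"
    by (simp add: assms in_x_X flip: in_x_mult) (simp add: in_x_mult in_x_X)
  finally have B: "var_x * in_x f / ((1 - var_x ^ 2) * (1 - var_y * var_x)) = ?B"
    by (rule fps_fps_divide_eqI) simp
  show ?thesis
    by (simp add: M_array_def M_gf_def A B) (simp add: bivariate_gf_def algebra_simps)
qed

section \<open>Arrays whose column factor depends on parity\<close>

text \<open>
  The factor \<open>(-1)\<^sup>j\<close> in column \<open>j\<close> can be moved to entry \<open>j\<close> of the vector that the matrix is
  applied to, which turns \<open>u(x)\<close> into \<open>u(-x)\<close>; the remaining sums over \<open>j\<close> are Cauchy products.
\<close>

lemma matrix_prod_reflection_array: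
  assumes t: "\<And>n k. t n k = ((fps_const ((- 1) ^ k) * a + b) * fps_X ^ k) $ n"
  shows "matrix_prod t (\<lambda>j k. u k $ j) = (\<lambda>n k. (a * (u k oo - fps_X) + b * u k) $ n)"
proof (intro ext)
  fix n k
  have "{j. t n j * u k $ j \<noteq> 0} \<subseteq> {0..n}"
    by (auto simp: t fps_X_power_mult_right_nth split: if_splits)
  then have "matrix_prod t (\<lambda>j k. u k $ j) n k = (\<Sum>j=0..n. t n j * u k $ j)"
    unfolding matrix_prod_def by (rule Sum_any.expand_superset[OF finite_atLeastAtMost])
  also have "\<dots> = (\<Sum>j=0..n. (u k oo - fps_X) $ j * a $ (n - j) + u k $ j * b $ (n - j))"
    by (intro sum.cong) (auto simp: t fps_X_power_mult_right_nth fps_reflect_nth distrib_right)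
  also have "\<dots> = ((u k oo - fps_X) * a + u k * b) $ n"
    by (simp add: fps_mult_nth sum.distrib)
  finally show "matrix_prod t (\<lambda>j k. u k $ j) n k = (a * (u k oo - fps_X) + b * u k) $ n"
    by (simp only: mult.commute)
qed

text \<open>
  The columns of \<open>t\<close> are themselves images of powers of \<open>x\<close>, so the action applied to them is the
  operator applied twice. Oddness of \<open>b\<close> makes the two mixed terms in \<open>u(-x)\<close> cancel.
\<close>

lemma matrix_prod_reflection_array_square:
  assumes t: "\<And>n k. t n k = ((fps_const ((- 1) ^ k) * a + b) * fps_X ^ k) $ n"
    and b: "b oo - fps_X = - b"
  shows "matrix_prod t t = appell_array (a * (a oo - fps_X) + b ^ 2)"
proof -
  define v where "v k = a * (fps_X ^ k oo - fps_X) + b * fps_X ^ k" for k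
  have t_v: "t = (\<lambda>n k. v k $ n)"
    by (simp add: fun_eq_iff t v_def fps_reflect_X_power algebra_simps)
  have "a * (v k oo - fps_X) + b * v k = (a * (a oo - fps_X) + b ^ 2) * fps_X ^ k" for k
  proof -
    have "(fps_X ^ k oo - fps_X) oo - fps_X = (fps_X ^ k :: complex fps)"
      by (simp add: fps_eq_iff fps_reflect_nth flip: mult.assoc power_mult_distrib)
    then have v_reflect: "v k oo - fps_X = (a oo - fps_X) * fps_X ^ k - b * (fps_X ^ k oo - fps_X)"
      by (simp add: v_def fps_compose_add_distrib fps_compose_mult_distrib b)
    show ?thesis
      unfolding v_reflect by (simp add: v_def algebra_simps power2_eq_square)
  qed
  then show ?thesis
    using matrix_prod_reflection_array[OF t, of v]
    by (simp flip: t_v add: appell_array_def)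
qed

text \<open>
  With \<open>F\<^sub>2 = x\<close> each pair of columns contributes the factor \<open>x F\<^sub>2 = x\<^sup>2\<close>, and \<open>F\<^sub>1\<close> is
  determined by \<open>G F\<^sub>1 = x (b - a)\<close> in column 1. The conditions at 0 make \<open>a + b\<close> invertible and
  give \<open>F\<^sub>1\<close> order exactly 1, with leading coefficient \<open>-1\<close>.
\<close>

lemma reflection_array_in_sprugnoli_arrays:
  assumes t: "\<And>n k. t n k = ((fps_const ((- 1) ^ k) * a + b) * fps_X ^ k) $ n"
    and a: "a $ 0 \<noteq> 0" and b: "b $ 0 = 0"
  shows "t \<in> sprugnoli_arrays"
proof -
  define F where "F = fps_X * ((b - a) * inverse (a + b))"
  have F: "(a + b) * F = fps_X * (b - a)"
  proof -
    have "(a + b) * F = fps_X * (b - a) * (inverse (a + b) * (a + b))"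
      by (simp add: F_def mult_ac)
    also have "inverse (a + b) * (a + b) = 1"
      using a b by (intro inverse_mult_eq_1) simp
    finally show ?thesis
      by simp
  qed
  have "t = sprugnoli_matrix (a + b) F fps_X"
  proof (intro ext)
    fix n k
    have X: "(fps_X * fps_X) ^ (k div 2) = (fps_X ^ (2 * (k div 2)) :: complex fps)"
      by (simp add: power_mult power2_eq_square)
    show "t n k = sprugnoli_matrix (a + b) F fps_X n k"
    proof (cases "even k")
      case True
      then show ?thesis
        by (simp add: t sprugnoli_matrix_def X)
    next
      case False
      then have "k mod 2 = 1" and k: "k = Suc (2 * (k div 2))"
        by presburger+
      then have "(a + b) * F ^ (k mod 2) * (fps_X * fps_X) ^ (k div 2)
          = (a + b) * F * fps_X ^ (2 * (k div 2))"
        by (simp add: X)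
      also have "\<dots> = (b - a) * (fps_X * fps_X ^ (2 * (k div 2)))"
        unfolding F by (simp only: mult_ac)
      also have "fps_X * fps_X ^ (2 * (k div 2)) = (fps_X ^ k :: complex fps)"
        by (subst (2) k) simp
      finally show ?thesis
        using False by (simp add: t sprugnoli_matrix_def flip: fps_const_neg)
    qed
  qed
  moreover have "a + b \<in> series_of_order 0" "F \<in> series_of_order 1" "fps_X \<in> series_of_order 1"
    using a b by (auto simp: series_of_order_def F_def)
  moreover have "fps_odd fps_X"
    by (simp add: fps_odd_def fps_X_def)
  ultimately show ?thesis
    unfolding sprugnoli_arrays_def by blast
qed

section \<open>A square root of the aerated Appell array\<close>

theorem corollary14:
  fixes h g f :: "complex fps"
  assumes "h \<in> series_of_order 0"
    and "g \<in> series_of_order 0"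
    and "f \<in> series_of_order 0"
    and "fps_even f"
    and "h oo fps_X ^ 2 =
           (g * (g oo - fps_X) * (1 - fps_X ^ 2) + fps_X ^ 2 * f ^ 2) / (1 - fps_X ^ 2) ^ 2"
  shows "M_array g f \<in> sprugnoli_arrays \<and>
         matrix_prod (M_array g f) (M_array g f) = appell_array (h oo fps_X ^ 2)"
proof -
  define d :: "complex fps" where "d = 1 - fps_X ^ 2"
  define a where "a = g * inverse (1 - fps_X)"
  define b where "b = fps_X * f * inverse d"
  have d_inv: "inverse d * d = 1"
    by (rule inverse_mult_eq_1) (simp add: d_def)
  have a: "a * (1 - fps_X) = g"
    unfolding a_def by (simp add: mult.assoc inverse_mult_eq_1)
  have b: "b * d = fps_X * f"
    unfolding b_def by (simp add: mult.assoc d_inv)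
  have entries: "M_array g f n k = ((fps_const ((- 1) ^ k) * a + b) * fps_X ^ k) $ n" for n k
    using a b unfolding d_def by (rule M_array_nth)
  have "fps_even d"
    by (auto simp: fps_even_def d_def fps_X_power_iff)
  then have d_even: "d oo - fps_X = d"
    by (rule fps_reflect_even)
  have b_odd: "b oo - fps_X = - b"
  proof -
    have "(b oo - fps_X) * d = (b * d) oo - fps_X"
      by (simp add: fps_compose_mult_distrib d_even)
    also have "\<dots> = - b * d"
      by (simp add: b fps_compose_mult_distrib fps_reflect_even[OF assms(4)])
    finally show ?thesis
      by (metis d_inv mult_right_cancel mult_zero_right zero_neq_one)
  qed
  have "a * (a oo - fps_X) + b ^ 2 = h oo fps_X ^ 2"
  proof -
    have "(a oo - fps_X) * (1 + fps_X) = g oo - fps_X"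
      unfolding a[symmetric] by (simp add: fps_compose_mult_distrib fps_reflect_one_minus_X)
    moreover have "d = (1 - fps_X) * (1 + fps_X)"
      by (simp add: d_def algebra_simps power2_eq_square)
    then have "a * (a oo - fps_X) * d = (a * (1 - fps_X)) * ((a oo - fps_X) * (1 + fps_X))"
      by (simp only: mult_ac)
    ultimately have "a * (a oo - fps_X) * d = g * (g oo - fps_X)"
      by (simp only: a)
    then have "(a * (a oo - fps_X) + b ^ 2) * d ^ 2
        = g * (g oo - fps_X) * d + (b * d) ^ 2"
      by (simp add: algebra_simps power2_eq_square)
    also have "\<dots> = g * (g oo - fps_X) * d + fps_X ^ 2 * f ^ 2"
      by (simp add: b power_mult_distrib)
    finally have "h oo fps_X ^ 2 = (a * (a oo - fps_X) + b ^ 2) * d ^ 2 / d ^ 2"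
      unfolding assms(5) d_def by simp
    moreover have "d ^ 2 \<noteq> 0"
      using d_inv by auto
    ultimately show ?thesis
      by simp
  qed
  moreover have "a $ 0 \<noteq> 0" "b $ 0 = 0"
    using assms(2) by (simp_all add: a_def b_def series_of_order_def)
  ultimately show ?thesis
    using reflection_array_in_sprugnoli_arrays[OF entries]
      matrix_prod_reflection_array_square[OF entries b_odd] by simp
qed

end
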